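(* Let $(X,d)$ be a (not necessarily symmetric) metric space having the convergence-symmetry property. Let $d_{\mathrm{arith}}(x,y)=\frac12(d(x,y)+d(y,x))$ and $d_{\mathrm{max}}(x,y)=\max\{d(x,y),d(y,x)\}$. Then the following three conditions are equivalent: (1) $(X,d)$ is complete; (2) $(X,d_{\mathrm{arith}})$ is complete; (3) $(X,d_{\mathrm{max}})$ is complete.
   Context: A (not necessarily symmetric) metric space is a non-empty set $X$ with $d:X\times X\to[0,\infty)$ such that $d(x,y)=0$ iff $x=y$, and $d(x,y)+d(y,z)\ge d(x,z)$ for all $x,y,z$. It has the convergence-symmetry property if for any two sequences $(p_n)$, $(q_n)$ in $X$ with $d(p_n,q_n)\to0$ one also has $d(q_n,p_n)\to0$ as $n\to\infty$. In such a space, a sequence $(x_n)$ is Cauchy if for every $\epsilon>0$ there is $N$ with $d(x_n,x_m)<\epsilon$ for all $n,m\ge N$ (equivalently, it is forward Cauchy: for every $\epsilon>0$ there is $N$ with $d(x_i,x_{i+k})<\epsilon$ for all $i\ge N$, $k\ge0$); $(x_n)$ converges to $x$ if $d(x_n,x)\to0$ (equivalently $d(x,x_n)\to0$); and the space is complete if every Cauchy sequence converges to some point. For the symmetric metrics $d_{\mathrm{arith}}$ and $d_{\mathrm{max}}$, completeness has its usual meaning. *)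

theory Defs
  imports "HOL-Analysis.Analysis"
begin

text \<open>
  Nonsymmetric analogue of the locale \<^locale>\<open>Metric_space\<close>: that locale's symmetry axiom is dropped
  and the carrier is required to be nonempty. As there, nonnegativity is assumed for the total
  function \<^term>\<open>d\<close>, which only normalizes the irrelevant values outside the carrier.
\<close>

locale nonsym_metric_space =
  fixes X :: "'a set" and d :: "'a \<Rightarrow> 'a \<Rightarrow> real"
  assumes carrier_nonempty: "X \<noteq> {}"
    and dist_nonneg: "\<And>x y. 0 \<le> d x y"
    and dist_zero: "\<And>x y. \<lbrakk>x \<in> X; y \<in> X\<rbrakk> \<Longrightarrow> d x y = 0 \<longleftrightarrow> x = y"
    and dist_triangle: "\<And>x y z. \<lbrakk>x \<in> X; y \<in> X; z \<in> X\<rbrakk> \<Longrightarrow> d x z \<le> d x y + d y z"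

definition convergence_symmetric :: "'a set \<Rightarrow> ('a \<Rightarrow> 'a \<Rightarrow> real) \<Rightarrow> bool" where
  "convergence_symmetric X d \<longleftrightarrow>
     (\<forall>p q :: nat \<Rightarrow> 'a. range p \<subseteq> X \<longrightarrow> range q \<subseteq> X \<longrightarrow>
        (\<lambda>n. d (p n) (q n)) \<longlonglongrightarrow> 0 \<longrightarrow> (\<lambda>n. d (q n) (p n)) \<longlonglongrightarrow> 0)"

text \<open>Both orders of the indices are covered, since \<^term>\<open>n\<close> and \<^term>\<open>m\<close> range independently.\<close>

definition nonsym_Cauchy :: "'a set \<Rightarrow> ('a \<Rightarrow> 'a \<Rightarrow> real) \<Rightarrow> (nat \<Rightarrow> 'a) \<Rightarrow> bool" where
  "nonsym_Cauchy X d s \<longleftrightarrow>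
     range s \<subseteq> X \<and> (\<forall>\<epsilon>>0. \<exists>N. \<forall>n m. N \<le> n \<longrightarrow> N \<le> m \<longrightarrow> d (s n) (s m) < \<epsilon>)"

definition nonsym_converges :: "'a set \<Rightarrow> ('a \<Rightarrow> 'a \<Rightarrow> real) \<Rightarrow> (nat \<Rightarrow> 'a) \<Rightarrow> 'a \<Rightarrow> bool" where
  "nonsym_converges X d s x \<longleftrightarrow> range s \<subseteq> X \<and> x \<in> X \<and> (\<lambda>n. d (s n) x) \<longlonglongrightarrow> 0"

definition nonsym_complete :: "'a set \<Rightarrow> ('a \<Rightarrow> 'a \<Rightarrow> real) \<Rightarrow> bool" where
  "nonsym_complete X d \<longleftrightarrow>
     (\<forall>s. nonsym_Cauchy X d s \<longrightarrow> (\<exists>x. nonsym_converges X d s x))"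

definition d_arith :: "('a \<Rightarrow> 'a \<Rightarrow> real) \<Rightarrow> 'a \<Rightarrow> 'a \<Rightarrow> real" where
  "d_arith d x y = (d x y + d y x) / 2"

definition d_max :: "('a \<Rightarrow> 'a \<Rightarrow> real) \<Rightarrow> 'a \<Rightarrow> 'a \<Rightarrow> real" where
  "d_max d x y = max (d x y) (d y x)"

text \<open>
  The following two facts justify applying the library's notion of completeness,
  \<^const>\<open>Metric_space.mcomplete\<close>, to the symmetrized metrics.
\<close>

lemma (in nonsym_metric_space) Metric_space_d_arith: "Metric_space X (d_arith d)"
proof
  show "0 \<le> d_arith d x y" for x y
    by (simp add: d_arith_def dist_nonneg)
  show "d_arith d x y = d_arith d y x" for x y
    by (simp add: d_arith_def)
  show "d_arith d x y = 0 \<longleftrightarrow> x = y" if "x \<in> X" "y \<in> X" for x y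
    using that dist_nonneg[of x y] dist_nonneg[of y x] dist_zero[of x y] dist_zero[of y x]
    by (auto simp: d_arith_def)
  show "d_arith d x z \<le> d_arith d x y + d_arith d y z" if "x \<in> X" "y \<in> X" "z \<in> X" for x y z
    using dist_triangle[of x y z] dist_triangle[of z y x] that
    by (simp add: d_arith_def field_simps)
qed

lemma (in nonsym_metric_space) Metric_space_d_max: "Metric_space X (d_max d)"
proof
  show "0 \<le> d_max d x y" for x y
    by (simp add: d_max_def dist_nonneg le_max_iff_disj)
  show "d_max d x y = d_max d y x" for x y
    by (simp add: d_max_def max.commute)
  show "d_max d x y = 0 \<longleftrightarrow> x = y" if "x \<in> X" "y \<in> X" for x y
    using that dist_nonneg[of x y] dist_nonneg[of y x] dist_zero[of x y] dist_zero[of y x]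
    by (auto simp: d_max_def max_def)
  show "d_max d x z \<le> d_max d x y + d_max d y z" if "x \<in> X" "y \<in> X" "z \<in> X" for x y z
    using dist_triangle[of x y z] dist_triangle[of z y x] that
    by (auto simp: d_max_def max_def)
qed

end

theory Submission
  imports Defs
begin

text \<open>
  Both symmetrizations lie between \<open>d x y / 2\<close> and \<open>d x y + d y x\<close>. Any symmetric metric \<open>e\<close> with
  these bounds has the same Cauchy sequences as \<open>d\<close>, and by convergence symmetry
  (applied to \<open>s\<close> and a constant sequence) \<open>d (s n) x\<close> tends to 0 if and only if \<open>e (s n) x\<close> does.
\<close>

lemma nonsym_Cauchy_iff_MCauchy:
  assumes e: "Metric_space X e"
    and lower: "\<And>x y. d x y \<le> 2 * e x y"
    and upper: "\<And>x y. e x y \<le> d x y + d y x"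
  shows "nonsym_Cauchy X d s \<longleftrightarrow> Metric_space.MCauchy X e s"
proof -
  interpret E: Metric_space X e by (fact e)
  show ?thesis
  proof
    assume C: "nonsym_Cauchy X d s"
    have "\<exists>N. \<forall>n m. N \<le> n \<longrightarrow> N \<le> m \<longrightarrow> e (s n) (s m) < \<epsilon>" if eps: "\<epsilon> > 0" for \<epsilon>
    proof -
      obtain N where N: "\<And>n m. N \<le> n \<Longrightarrow> N \<le> m \<Longrightarrow> d (s n) (s m) < \<epsilon> / 2"
        using C eps unfolding nonsym_Cauchy_def by (meson half_gt_zero)
      have "e (s n) (s m) < \<epsilon>" if "N \<le> n" "N \<le> m" for n m
        \<comment> \<open>The Cauchy condition for \<open>d\<close> covers both orders of the
          indices, so each of the two terms in \<open>upper\<close> is below half of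
          \<open>\<epsilon>\<close>.\<close>
        using upper[of "s n" "s m"] N[of n m] N[of m n] that by linarith
      then show ?thesis by blast
    qed
    then show "E.MCauchy s"
      using C by (simp add: nonsym_Cauchy_def E.MCauchy_def)
  next
    assume C: "E.MCauchy s"
    have "\<exists>N. \<forall>n m. N \<le> n \<longrightarrow> N \<le> m \<longrightarrow> d (s n) (s m) < \<epsilon>" if eps: "\<epsilon> > 0" for \<epsilon>
    proof -
      obtain N where N: "\<And>n m. N \<le> n \<Longrightarrow> N \<le> m \<Longrightarrow> e (s n) (s m) < \<epsilon> / 2"
        using C eps unfolding E.MCauchy_def by (meson half_gt_zero)
      have "d (s n) (s m) < \<epsilon>" if "N \<le> n" "N \<le> m" for n m
        using lower[of "s n" "s m"] N[of n m] that by linarith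
      then show ?thesis by blast
    qed
    then show "nonsym_Cauchy X d s"
      using C by (simp add: nonsym_Cauchy_def E.MCauchy_def)
  qed
qed

text \<open>Unlike the Cauchy condition, \<open>nonsym_converges\<close> controls one order of the
  arguments; \<open>sym\<close> controls the reversed distance \<open>d x (s n)\<close>, which
  \<open>upper\<close> also involves.\<close>

lemma nonsym_converges_iff_limitin:
  assumes d: "nonsym_metric_space X d" and sym: "convergence_symmetric X d"
    and e: "Metric_space X e"
    and lower: "\<And>x y. d x y \<le> 2 * e x y"
    and upper: "\<And>x y. e x y \<le> d x y + d y x"
    and s: "range s \<subseteq> X"
  shows "nonsym_converges X d s x \<longleftrightarrow> limitin (Metric_space.mtopology X e) s x sequentially"
proof -
  interpret D: nonsym_metric_space X d by (fact d)
  interpret E: Metric_space X e by (fact e)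
  have "(\<lambda>n. e (s n) x) \<longlonglongrightarrow> 0" if x: "x \<in> X" and lim: "(\<lambda>n. d (s n) x) \<longlonglongrightarrow> 0"
  proof -
    have "(\<lambda>n. d x (s n)) \<longlonglongrightarrow> 0"
      using sym[unfolded convergence_symmetric_def, rule_format, of s "\<lambda>_. x"] s x lim by simp
    then have "(\<lambda>n. d (s n) x + d x (s n)) \<longlonglongrightarrow> 0"
      using tendsto_add[OF lim] by fastforce
    then show ?thesis
      \<comment> \<open>The rotation makes the chained limit match the premise on the upper
        sequence; the lower sequence stays schematic for \<open>auto\<close>.\<close>
      by (rule tendsto_sandwich[rotated 3]) (auto simp: upper)
  qed
  moreover have "(\<lambda>n. d (s n) x) \<longlonglongrightarrow> 0" if "(\<lambda>n. e (s n) x) \<longlonglongrightarrow> 0"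
    by (rule tendsto_sandwich[OF _ _ tendsto_const tendsto_mult_right_zero[OF that, of 2]])
      (auto simp: D.dist_nonneg lower)
  ultimately show ?thesis
    using s by (auto simp: nonsym_converges_def E.limitin_metric_dist_null image_subset_iff)
qed

text \<open>Stated for an arbitrary \<open>e\<close> within the two bounds, so that one argument
  serves both symmetrizations.\<close>

lemma nonsym_complete_iff_mcomplete:
  assumes "nonsym_metric_space X d" and "convergence_symmetric X d"
    and e: "Metric_space X e"
    and "\<And>x y. d x y \<le> 2 * e x y"
    and "\<And>x y. e x y \<le> d x y + d y x"
  shows "nonsym_complete X d \<longleftrightarrow> Metric_space.mcomplete X e"
proof -
  have "(\<exists>x. nonsym_converges X d s x) \<longleftrightarrow>
      (\<exists>x. limitin (Metric_space.mtopology X e) s x sequentially)"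
    if "Metric_space.MCauchy X e s" for s
    \<comment> \<open>\<open>MCauchy\<close> includes \<open>range s \<subseteq> X\<close>, the
      remaining premise of the convergence equivalence.\<close>
    using that nonsym_converges_iff_limitin[OF assms] Metric_space.MCauchy_def[OF e] by blast
  then show ?thesis
    unfolding nonsym_complete_def Metric_space.mcomplete_def[OF e]
    by (simp add: nonsym_Cauchy_iff_MCauchy[OF assms(3-5)] cong: imp_cong)
qed

theorem proposition6p8:
  fixes X :: "'a set" and d :: "'a \<Rightarrow> 'a \<Rightarrow> real"
  assumes "nonsym_metric_space X d"
    and "convergence_symmetric X d"
  shows "(nonsym_complete X d \<longleftrightarrow> Metric_space.mcomplete X (d_arith d))
       \<and> (Metric_space.mcomplete X (d_arith d) \<longleftrightarrow> Metric_space.mcomplete X (d_max d))"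
proof -
  interpret nonsym_metric_space X d by (fact assms(1))
  have "nonsym_complete X d \<longleftrightarrow> Metric_space.mcomplete X (d_arith d)"
    \<comment> \<open>Since \<open>2 * d_arith d x y\<close> equals \<open>d x y + d y x\<close>,
      both bounds follow from nonnegativity.\<close>
    by (rule nonsym_complete_iff_mcomplete[OF assms Metric_space_d_arith])
      (auto simp: d_arith_def field_simps dist_nonneg add_nonneg_nonneg)
  moreover have "nonsym_complete X d \<longleftrightarrow> Metric_space.mcomplete X (d_max d)"
  proof (rule nonsym_complete_iff_mcomplete[OF assms Metric_space_d_max])
    show "d x y \<le> 2 * d_max d x y" for x y
      using dist_nonneg[of x y] unfolding d_max_def by linarith
    \<comment> \<open>The maximum of two nonnegative reals is at most their sum.\<close>
    show "d_max d x y \<le> d x y + d y x" for x y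
      by (simp add: d_max_def dist_nonneg)
  qed
  ultimately show ?thesis by blast
qed

end
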